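(* Let $d$ be a positive integer, let $\epsilon>0$ and let $n\in\mathbb{N}^d$. Then for every free measure-preserving action $f$ of $\mathbb{N}_0^d$ on an atomless standard probability space $(X,\mathcal{X},\mu)$, there exists an $n$-tower for $f$ of measure at least $1-\epsilon$; that is, there exists $B\in\mathcal{X}$ such that the sets $f_k^{-1}(B)$, $k\in\mathbb{N}_0^d$ with $k<n$, are pairwise disjoint and $\mu\big(\bigcup_{0\le k<n} f_k^{-1}(B)\big)\ge 1-\epsilon$.
   Context: $\mathbb{N}$ is the set of positive integers and $\mathbb{N}_0$ the set of non-negative integers. An endomorphism on $X$ is a measure-preserving transformation $X\to X$ (not necessarily invertible). A measure-preserving action of $\mathbb{N}_0^d$ on $X$ is a map $f:\mathbb{N}_0^d\times X\to X$ such that for each $n\in\mathbb{N}_0^d$ the map $f_n:X\to X$, $x\mapsto f(n,x)$ is an endomorphism on $X$, $f_0$ is the identity map, and $f_{m+n}(x)=f_m(f_n(x))$ for all $m,n\in\mathbb{N}_0^d$ and $x\in X$. The action is free if for every distinct $k,\ell\in\mathbb{N}_0^d$ we have $\mu(\{x\in X: f_k(x)=f_\ell(x)\})=0$. For $k,\ell\in\mathbb{N}_0^d$, $k<\ell$ (resp. $k\le\ell$) means $k(j)<\ell(j)$ (resp. $k(j)\le \ell(j)$) for every $j\in\{1,\dots,d\}$. For $n\in\mathbb{N}^d$ and $B\in\mathcal{X}$, if the preimages $f_k^{-1}(B)$, $0\le k<n$, are pairwise disjoint, then their union $B_{(n)}=\bigcup_{0\le k<n}f_k^{-1}(B)$ is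 called an $n$-tower for $f$ with base $B$, and its measure is $\mu(B_{(n)})$. *)

theory Defs
  imports "HOL-Probability.Probability"
begin

text \<open>
  The library has Polish spaces only as a type class and \<^const>\<open>borel\<close> only on topological types.
  The space of a measure is a set, so the abstract topologies are used here.
\<close>

definition standard_borel_space :: "'a measure \<Rightarrow> bool" where
  "standard_borel_space M \<longleftrightarrow>
     (\<exists>T. topspace T = space M \<and> separable_space T \<and> completely_metrizable_space T \<and>
          sets M = sigma_sets (space M) {U. openin T U})"

text \<open>
  The literature uses three conventions for standard probability spaces: a Borel probability
  measure on a standard Borel space, the completion of one, or a space isomorphic to one of these
  after removal of a null set (Rokhlin's Lebesgue spaces). The definition admits all three.
\<close>

definition standard_prob_space :: "'a measure \<Rightarrow> bool" where
  "standard_prob_space M \<longleftrightarrow>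
     prob_space M \<and>
     (\<exists>X\<^sub>0 \<in> sets M. space M - X\<^sub>0 \<in> null_sets M \<and>
        (\<exists>N. standard_borel_space N \<and>
             (restrict_space M X\<^sub>0 = N \<or> restrict_space M X\<^sub>0 = completion N)))"

definition atomless :: "'a measure \<Rightarrow> bool" where
  "atomless M \<longleftrightarrow>
     (\<forall>A \<in> sets M. emeasure M A > 0 \<longrightarrow>
        (\<exists>B \<in> sets M. B \<subseteq> A \<and> 0 < emeasure M B \<and> emeasure M B < emeasure M A))"

definition endomorphism :: "'a measure \<Rightarrow> ('a \<Rightarrow> 'a) \<Rightarrow> bool" where
  "endomorphism M T \<longleftrightarrow>
     T \<in> M \<rightarrow>\<^sub>M M \<and> (\<forall>A \<in> sets M. emeasure M (T -` A \<inter> space M) = emeasure M A)"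

definition mp_action :: "'a measure \<Rightarrow> (nat ^ 'd \<Rightarrow> 'a \<Rightarrow> 'a) \<Rightarrow> bool" where
  "mp_action M f \<longleftrightarrow>
     (\<forall>k. endomorphism M (f k)) \<and>
     (\<forall>x \<in> space M. f 0 x = x) \<and>
     (\<forall>k l. \<forall>x \<in> space M. f (k + l) x = f k (f l x))"

definition free_action :: "'a measure \<Rightarrow> (nat ^ 'd \<Rightarrow> 'a \<Rightarrow> 'a) \<Rightarrow> bool" where
  "free_action M f \<longleftrightarrow>
     (\<forall>k l. k \<noteq> l \<longrightarrow> {x \<in> space M. f k x = f l x} \<in> null_sets M)"

text \<open>
  The order \<open><\<close> of the library on vectors is not strict in every coordinate,
  so the index set of a tower is written out.
\<close>

definition tower_indices :: "nat ^ 'd \<Rightarrow> (nat ^ 'd) set" where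
  "tower_indices n = {k. \<forall>j. k $ j < n $ j}"

definition tower_base :: "'a measure \<Rightarrow> (nat ^ 'd \<Rightarrow> 'a \<Rightarrow> 'a) \<Rightarrow> nat ^ 'd \<Rightarrow> 'a set \<Rightarrow> bool" where
  "tower_base M f n B \<longleftrightarrow>
     B \<in> sets M \<and> disjoint_family_on (\<lambda>k. f k -` B \<inter> space M) (tower_indices n)"

definition tower :: "'a measure \<Rightarrow> (nat ^ 'd \<Rightarrow> 'a \<Rightarrow> 'a) \<Rightarrow> nat ^ 'd \<Rightarrow> 'a set \<Rightarrow> 'a set" where
  "tower M f n B = (\<Union>k \<in> tower_indices n. f k -` B \<inter> space M)"

end

theory Submission
  imports Defs
begin

text \<open>
  Let \<open>C\<close> be the base of a \<open>pn\<close>-tower \<open>T\<close>. An \<open>n\<close>-tower base \<open>B\<close> can be changed to agree with the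
  regular pattern \<open>\<Union>f\<^bsub>nq\<^esub>\<inverse>(C)\<close>, \<open>1 \<le> q < p\<close>, on \<open>T\<close> while deleting the rest of
  \<open>B \<inter> T\<close>. Starting the pattern at \<open>q = 1\<close> leaves a margin in \<open>T\<close>, so conflicts between the two parts
  are detected along forward orbits and no images of sets are needed, although \<open>f\<close> is not
  invertible. The new tower contains the old one and \<open>T\<close> up to a boundary of measure \<open>\<le> s |pn| \<mu>(C)\<close>,
  where \<open>s\<close> is small for large \<open>p\<close>.

  By freeness almost all of \<open>X\<close> is partitioned into finitely many bases \<open>C\<^sub>1, \<dots>, C\<^sub>r\<close> of \<open>pn\<close>-towers
  \<open>T\<^sub>i\<close>. If \<open>E\<close> is the complement of the \<open>n\<close>-tower of \<open>B\<close>, then \<open>\<Sum>\<mu>(T\<^sub>i \<inter> E)\<close> is nearly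
  \<open>|pn| \<mu>(E)\<close>, whereas the boundaries cost at most \<open>s |pn|\<close> altogether. So as long as \<open>\<mu>(E) > \<epsilon>\<close>,
  one of the \<open>C\<^sub>i\<close> enlarges the tower by an amount that does not depend on \<open>B\<close>, and this can happen
  only finitely often.
\<close>

section \<open>Counting lattice points in boxes\<close>

lemma bij_betw_PiE_Collect_vec:
  "bij_betw vec_lambda (\<Pi>\<^sub>E j\<in>UNIV. S j) {k :: 'b ^ 'd. \<forall>j. k $ j \<in> S j}"
  by (rule bij_betwI[where g = vec_nth]) (auto simp: vec_lambda_inverse)

lemma finite_vec_box: "finite {k :: nat ^ 'd. \<forall>j. a $ j \<le> k $ j \<and> k $ j < b $ j}"
  and card_vec_box: "card {k :: nat ^ 'd. \<forall>j. a $ j \<le> k $ j \<and> k $ j < b $ j} = (\<Prod>j\<in>UNIV. b $ j - a $ j)"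
proof -
  have *: "bij_betw vec_lambda (\<Pi>\<^sub>E j\<in>UNIV. {a $ j..<b $ j}) {k :: nat ^ 'd. \<forall>j. a $ j \<le> k $ j \<and> k $ j < b $ j}"
    using bij_betw_PiE_Collect_vec[of "\<lambda>j. {a $ j..<b $ j}"] by simp
  show "finite {k :: nat ^ 'd. \<forall>j. a $ j \<le> k $ j \<and> k $ j < b $ j}"
    using bij_betw_finite[OF *] by (simp add: finite_PiE)
  show "card {k :: nat ^ 'd. \<forall>j. a $ j \<le> k $ j \<and> k $ j < b $ j} = (\<Prod>j\<in>UNIV. b $ j - a $ j)"
    using bij_betw_same_card[OF *] by (simp add: card_PiE)
qed

lemma finite_tower_indices: "finite (tower_indices n)"
  using finite_vec_box[of 0 n] by (simp add: tower_indices_def)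

lemma card_tower_indices: "card (tower_indices n) = (\<Prod>j\<in>UNIV. n $ j)"
  using card_vec_box[of 0 n] by (simp add: tower_indices_def)

text \<open>This shell counts the preimages of the base of the large tower that form the boundary
  error. The outer box has sides \<open>(p + 1) * n $ j\<close>, the inner one
  \<open>(p - 1) * n $ j\<close>.\<close>

lemma card_tower_indices_diff_box:
  fixes n :: "nat ^ 'd"
  assumes "p > 0"
  shows "card (tower_indices (\<chi> j. (p + 1) * n $ j) - {k. \<forall>j. n $ j \<le> k $ j \<and> k $ j < p * n $ j})
    = ((p + 1) ^ CARD('d) - (p - 1) ^ CARD('d)) * card (tower_indices n)"
proof -
  let ?K = "{k. \<forall>j. n $ j \<le> k $ j \<and> k $ j < p * n $ j}"
  have K: "finite ?K" "card ?K = (p - 1) ^ CARD('d) * card (tower_indices n)"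
    using finite_vec_box[of n "\<chi> j. p * n $ j"] card_vec_box[of n "\<chi> j. p * n $ j"]
    by (simp_all add: card_tower_indices prod.distrib flip: diff_mult_distrib[where n = 1, simplified])
  have "?K \<subseteq> tower_indices (\<chi> j. (p + 1) * n $ j)"
    by (auto simp: tower_indices_def intro: less_le_trans)
  then have "card (tower_indices (\<chi> j. (p + 1) * n $ j) - ?K)
      = card (tower_indices (\<chi> j. (p + 1) * n $ j)) - card ?K"
    by (rule card_Diff_subset[OF K(1)])
  also have "card (tower_indices (\<chi> j. (p + 1) * n $ j)) = (p + 1) ^ CARD('d) * card (tower_indices n)"
    unfolding card_tower_indices vec_lambda_beta prod.distrib by simp
  finally show ?thesis
    by (simp add: K(2) diff_mult_distrib)
qed

text \<open>Divided by \<open>p ^ d\<close>, both powers tend to 1.\<close>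

lemma ex_power_shell_small:
  assumes "\<delta> > (0 :: real)"
  obtains p :: nat where "p > 0" "real ((p + 1) ^ d - (p - 1) ^ d) \<le> \<delta> * real p ^ d"
proof -
  have "(\<lambda>p. (1 + 1 / real p) ^ d - (1 - 1 / real p) ^ d) \<longlonglongrightarrow> (1 + 0) ^ d - (1 - 0) ^ d"
    by (intro tendsto_intros lim_1_over_n)
  then have "eventually (\<lambda>p. (1 + 1 / real p) ^ d - (1 - 1 / real p) ^ d < \<delta>) sequentially"
    using assms by (intro order_tendstoD(2)) auto
  then obtain p where p: "p > 0" "(1 + 1 / real p) ^ d - (1 - 1 / real p) ^ d < \<delta>"
    using eventually_conj[OF _ eventually_gt_at_top[of 0]] by (metis (lifting) eventually_happens' sequentially_bot)
  have "real ((p + 1) ^ d - (p - 1) ^ d) = (real p + 1) ^ d - (real p - 1) ^ d"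
    using p(1) by (simp add: of_nat_diff power_mono add.commute)
  also have "\<dots> = ((1 + 1 / real p) ^ d - (1 - 1 / real p) ^ d) * real p ^ d"
  proof -
    have "(1 + 1 / real p) * real p = real p + 1" "(1 - 1 / real p) * real p = real p - 1"
      using p(1) by (simp_all add: field_simps)
    then show ?thesis
      unfolding left_diff_distrib power_mult_distrib[symmetric] by simp
  qed
  also have "\<dots> \<le> \<delta> * real p ^ d"
    using p(2) by (intro mult_right_mono) auto
  finally show thesis
    using p(1) that by blast
qed

section \<open>Countable separating families\<close>

text \<open>Balls of radius \<open>1 / Suc i\<close> about a countable dense set suffice: once the
  radius is below half of \<open>d x y\<close>, no such ball contains both points.\<close>

lemma separable_metrizable_imp_separating_open_sets:
  assumes "separable_space X" "metrizable_space X"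
  obtains \<U> where "countable \<U>" "\<And>U. U \<in> \<U> \<Longrightarrow> openin X U"
    "\<And>x y. \<lbrakk>x \<in> topspace X; y \<in> topspace X; x \<noteq> y\<rbrakk> \<Longrightarrow> \<exists>U\<in>\<U>. x \<in> U \<and> y \<notin> U"
proof -
  obtain S d where "Metric_space S d" and X: "X = Metric_space.mtopology S d"
    using assms(2) by (auto simp: metrizable_space_def)
  then interpret Metric_space S d by simp
  obtain D where D: "countable D" "D \<subseteq> S" "mtopology closure_of D = S"
    using assms(1) by (auto simp: separable_space_def X)
  define \<U> where "\<U> = (\<Union>c\<in>D. range (\<lambda>i. mball c (1 / Suc i)))"
  have sep: "\<exists>U\<in>\<U>. x \<in> U \<and> y \<notin> U" if "x \<in> S" "y \<in> S" "x \<noteq> y" for x y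
  proof -
    have "0 < d x y / 2"
      using that by simp
    then obtain i where i: "1 / Suc i < d x y / 2"
      using reals_Archimedean by (metis inverse_eq_divide)
    have "x \<in> mtopology closure_of D"
      using D that by simp
    then obtain c where c: "c \<in> D" "c \<in> mball x (1 / Suc i)"
      unfolding metric_closure_of by (auto simp del: of_nat_Suc) (metis in_mball of_nat_0_less_iff zero_less_Suc zero_less_divide_1_iff)
    have "d x y \<le> d c x + d c y"
      using triangle''[of x c y] c that by (auto simp: commute)
    then have "\<not> d c y < 1 / Suc i"
      using c i by (auto simp: commute simp del: of_nat_Suc)
    then have "x \<in> mball c (1 / Suc i)" "y \<notin> mball c (1 / Suc i)"
      using c that by (auto simp: commute)
    then show ?thesis
      using c(1) by (auto simp: \<U>_def simp del: in_mball)
  qed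
  show thesis
    by (rule that[of \<U>]) (use D sep in \<open>auto simp: \<U>_def X\<close>)
qed

text \<open>Completion only adds measurable sets, and \<open>X\<^sub>0\<close> is measurable, so the
  open sets of the Polish space belong to \<open>sets M\<close> under each convention.\<close>

lemma standard_prob_space_separating_sets:
  assumes "standard_prob_space M"
  obtains \<U> X\<^sub>0 where "countable \<U>" "\<U> \<subseteq> sets M" "X\<^sub>0 \<in> sets M" "space M - X\<^sub>0 \<in> null_sets M"
    "\<And>x y. \<lbrakk>x \<in> X\<^sub>0; y \<in> X\<^sub>0; x \<noteq> y\<rbrakk> \<Longrightarrow> \<exists>U\<in>\<U>. x \<in> U \<and> y \<notin> U"
proof -
  obtain X\<^sub>0 N where X\<^sub>0: "X\<^sub>0 \<in> sets M" "space M - X\<^sub>0 \<in> null_sets M"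
    and N: "standard_borel_space N" "restrict_space M X\<^sub>0 = N \<or> restrict_space M X\<^sub>0 = completion N"
    using assms by (auto simp: standard_prob_space_def)
  obtain T where T: "topspace T = space N" "separable_space T" "completely_metrizable_space T"
    "sets N = sigma_sets (space N) {U. openin T U}"
    using N(1) by (auto simp: standard_borel_space_def)
  obtain \<U> where \<U>: "countable \<U>" "\<And>U. U \<in> \<U> \<Longrightarrow> openin T U"
    "\<And>x y. \<lbrakk>x \<in> topspace T; y \<in> topspace T; x \<noteq> y\<rbrakk> \<Longrightarrow> \<exists>U\<in>\<U>. x \<in> U \<and> y \<notin> U"
    using separable_metrizable_imp_separating_open_sets[OF T(2) completely_metrizable_imp_metrizable_space[OF T(3)]]
    by blast
  have "space (restrict_space M X\<^sub>0) = X\<^sub>0"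
    using X\<^sub>0(1) sets.sets_into_space by (auto simp: space_restrict_space)
  with N(2) T(1) have top: "topspace T = X\<^sub>0"
    by auto
  have "sets N \<subseteq> sets (restrict_space M X\<^sub>0)"
    using N(2) by (auto intro: sets_completionI_sub)
  moreover have "U \<in> sets N" if "U \<in> \<U>" for U
    using \<U>(2)[OF that] T(4) by (auto intro: sigma_sets.Basic)
  moreover have "sets (restrict_space M X\<^sub>0) \<subseteq> sets M"
    using X\<^sub>0(1) by (auto simp: sets_restrict_space)
  ultimately have "\<U> \<subseteq> sets M"
    by blast
  with \<U> X\<^sub>0 top show thesis
    by (intro that[of \<U> X\<^sub>0]) auto
qed

section \<open>Orbits and measures of towers\<close>

locale mp_system = prob_space M for M :: "'a measure" +
  fixes f :: "nat ^ 'd \<Rightarrow> 'a \<Rightarrow> 'a"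
  assumes action: "mp_action M f"
begin

lemma measurable_f [measurable]: "f k \<in> M \<rightarrow>\<^sub>M M"
  using action by (auto simp: mp_action_def endomorphism_def)

lemma f_in_space: "x \<in> space M \<Longrightarrow> f k x \<in> space M"
  using measurable_f measurable_space by metis

lemma f_f: "x \<in> space M \<Longrightarrow> f k (f l x) = f (k + l) x"
  using action by (auto simp: mp_action_def)

lemma emeasure_vimage_f: "A \<in> sets M \<Longrightarrow> emeasure M (f k -` A \<inter> space M) = emeasure M A"
  using action by (auto simp: mp_action_def endomorphism_def)

lemma measure_vimage_f: "A \<in> sets M \<Longrightarrow> prob (f k -` A \<inter> space M) = prob A"
  by (simp add: measure_def emeasure_vimage_f)

lemma tower_baseI:
  assumes "B \<in> sets M"
    and "\<And>x k l. \<lbrakk>x \<in> space M; k \<in> tower_indices n; l \<in> tower_indices n; f k x \<in> B; f l x \<in> B\<rbrakk> \<Longrightarrow> k = l"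
  shows "tower_base M f n B"
  using assms unfolding tower_base_def disjoint_family_on_def by blast

lemma tower_baseD:
  assumes "tower_base M f n B" "x \<in> space M" "k \<in> tower_indices n" "l \<in> tower_indices n" "f k x \<in> B" "f l x \<in> B"
  shows "k = l"
  using assms unfolding tower_base_def disjoint_family_on_def by blast

lemma tower_base_sets: "tower_base M f n B \<Longrightarrow> B \<in> sets M"
  by (simp add: tower_base_def)

lemma tower_base_subset:
  assumes "tower_base M f n B" "A \<subseteq> B" "A \<in> sets M"
  shows "tower_base M f n A"
  using assms(2,3) tower_baseD[OF assms(1)] by (intro tower_baseI) blast+

lemma sets_tower [measurable]: "B \<in> sets M \<Longrightarrow> tower M f n B \<in> sets M"
  unfolding tower_def using finite_tower_indices by (intro sets.finite_UN) auto

lemma measure_tower_Int: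
  assumes "tower_base M f n B" "E \<in> sets M"
  shows "prob (tower M f n B \<inter> E) = (\<Sum>k\<in>tower_indices n. prob (f k -` B \<inter> space M \<inter> E))"
proof -
  have "tower M f n B \<inter> E = (\<Union>k\<in>tower_indices n. f k -` B \<inter> space M \<inter> E)"
    by (auto simp: tower_def)
  also have "prob \<dots> = (\<Sum>k\<in>tower_indices n. prob (f k -` B \<inter> space M \<inter> E))"
    using tower_base_sets[OF assms(1)] assms(2) finite_tower_indices
    by (intro finite_measure_finite_Union)
      (auto simp: disjoint_family_on_def dest: tower_baseD[OF assms(1)])
  finally show ?thesis .
qed

lemma measure_tower:
  assumes "tower_base M f n B"
  shows "prob (tower M f n B) = card (tower_indices n) * prob B"
proof -
  have B: "B \<in> sets M" by (rule tower_base_sets[OF assms])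
  then show ?thesis
    using measure_tower_Int[OF assms sets.top] sets.sets_into_space[OF sets_tower[OF B, of n]]
    by (simp add: Int_absorb2 Int_assoc measure_vimage_f)
qed

lemma AE_f_in:
  assumes "space M - A \<in> null_sets M"
  shows "AE x in M. f k x \<in> A"
proof (rule AE_I')
  show "f k -` (space M - A) \<inter> space M \<in> null_sets M"
    using assms by (auto simp: null_sets_def emeasure_vimage_f)
  show "{x \<in> space M. f k x \<notin> A} \<subseteq> f k -` (space M - A) \<inter> space M"
    by (auto intro: f_in_space)
qed

section \<open>Covers by tower bases\<close>

text \<open>
  If \<open>f\<^sub>k x\<close> and \<open>f\<^sub>l x\<close> both lay in the set, then \<open>f\<^bsub>k+l\<^esub> x\<close> would lie both inside and outside
  \<open>\<phi> k l\<close>. Only commutativity is used, so the sets \<open>\<phi> k l\<close> may be arbitrary.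
\<close>

lemma tower_base_of_separating_sets:
  assumes "\<And>k l. \<phi> k l \<in> sets M"
  shows "tower_base M f n {x \<in> space M. \<forall>k\<in>tower_indices n. \<forall>l\<in>tower_indices n - {k}.
           f l x \<in> \<phi> k l \<and> f k x \<notin> \<phi> k l}" (is "tower_base M f n ?A")
proof (rule tower_baseI)
  have [measurable]: "\<phi> k l \<in> sets M" for k l by (rule assms)
  show "?A \<in> sets M"
    using finite_tower_indices by (intro sets.sets_Collect_finite_All) auto
  fix x k l
  assume x: "x \<in> space M" "k \<in> tower_indices n" "l \<in> tower_indices n" "f k x \<in> ?A" "f l x \<in> ?A"
  show "k = l"
  proof (rule ccontr)
    assume "k \<noteq> l"
    with x have "f l (f k x) \<in> \<phi> k l" "f k (f l x) \<notin> \<phi> k l"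
      by auto
    then show False
      using x(1) by (simp add: f_f add.commute)
  qed
qed

text \<open>For almost every \<open>x\<close> the points \<open>f k x\<close> are distinct and lie
  in \<open>X\<^sub>0\<close>, so a countable family separates them. One base is formed for each
  choice of a separating set per pair of indices; the choices are countable because the index box is
  finite.\<close>

lemma tower_base_countable_cover:
  assumes "standard_prob_space M" "free_action M f"
  obtains A :: "nat \<Rightarrow> 'a set" where "\<And>i. tower_base M f n (A i)" "prob (\<Union>i. A i) = 1"
proof -
  obtain \<U> X\<^sub>0 where \<U>: "countable \<U>" "\<U> \<subseteq> sets M"
    and X\<^sub>0: "space M - X\<^sub>0 \<in> null_sets M"
    and sep: "\<And>x y. \<lbrakk>x \<in> X\<^sub>0; y \<in> X\<^sub>0; x \<noteq> y\<rbrakk> \<Longrightarrow> \<exists>U\<in>\<U>. x \<in> U \<and> y \<notin> U"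
    using standard_prob_space_separating_sets[OF assms(1)] by metis
  let ?I = "tower_indices n"
  \<comment> \<open>The empty set serves as value on the diagonal and keeps \<open>\<Phi>\<close>
    nonempty, so that it can be enumerated.\<close>
  define \<Phi> where "\<Phi> = (\<Pi>\<^sub>E k\<in>?I. \<Pi>\<^sub>E l\<in>?I. insert {} \<U>)"
  define A where "A \<phi> = {x \<in> space M. \<forall>k\<in>?I. \<forall>l\<in>?I - {k}. f l x \<in> \<phi> k l \<and> f k x \<notin> \<phi> k l}"
    for \<phi> :: "nat ^ 'd \<Rightarrow> nat ^ 'd \<Rightarrow> 'a set"
  have \<Phi>: "countable \<Phi>" "\<Phi> \<noteq> {}"
    unfolding \<Phi>_def using \<U>(1) finite_tower_indices[of n]
    by (auto intro!: countable_PiE simp: PiE_eq_empty_iff)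
  have base: "tower_base M f n (A \<phi>)" if "\<phi> \<in> \<Phi>" for \<phi>
  proof -
    \<comment> \<open>Outside the index box \<open>\<phi>\<close> has an unspecified default value,
      perhaps not measurable; resetting it to \<open>{}\<close> leaves the base unchanged.\<close>
    define \<psi> where "\<psi> k l = (if k \<in> ?I \<and> l \<in> ?I then \<phi> k l else {})" for k l
    have "A \<phi> = A \<psi>"
      by (auto simp: A_def \<psi>_def)
    moreover have "\<psi> k l \<in> sets M" for k l
    proof (cases "k \<in> ?I \<and> l \<in> ?I")
      case True
      then have "\<phi> k l \<in> insert {} \<U>"
        using that unfolding \<Phi>_def by (meson PiE_mem)
      with True \<U>(2) show ?thesis
        by (auto simp: \<psi>_def)
    qed (auto simp: \<psi>_def)
    ultimately show ?thesis
      using tower_base_of_separating_sets[of \<psi> n] by (simp add: A_def)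
  qed
  have "AE x in M. k \<noteq> l \<longrightarrow> f k x \<noteq> f l x" for k l
    using assms(2) by (cases "k = l") (auto simp: free_action_def intro: AE_I')
  then have "AE x in M. \<forall>k l. k \<noteq> l \<longrightarrow> f k x \<noteq> f l x"
    by (simp add: AE_all_countable)
  moreover have "AE x in M. \<forall>k. f k x \<in> X\<^sub>0"
    using AE_f_in[OF X\<^sub>0] by (simp add: AE_all_countable)
  ultimately have "AE x in M. x \<in> (\<Union>\<phi>\<in>\<Phi>. A \<phi>)"
    using AE_space
  proof eventually_elim
    case (elim x)
    then have "\<forall>k l. \<exists>U. k \<noteq> l \<longrightarrow> U \<in> \<U> \<and> f l x \<in> U \<and> f k x \<notin> U"
      using sep by metis
    then obtain U where U: "\<And>k l. k \<noteq> l \<Longrightarrow> U k l \<in> \<U> \<and> f l x \<in> U k l \<and> f k x \<notin> U k l"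
      by metis
    define \<phi> where "\<phi> = (\<lambda>k\<in>?I. \<lambda>l\<in>?I. if k = l then {} else U k l)"
    have "\<phi> \<in> \<Phi>"
      using U by (auto simp: \<phi>_def \<Phi>_def)
    moreover have "x \<in> A \<phi>"
      using U elim by (auto simp: A_def \<phi>_def)
    ultimately show ?case
      by blast
  qed
  moreover have "(\<Union>\<phi>\<in>\<Phi>. A \<phi>) = (\<Union>i. A (from_nat_into \<Phi> i))"
    using range_from_nat_into[OF \<Phi>(2,1)] by (metis image_image)
  ultimately have "AE x in M. x \<in> (\<Union>i. A (from_nat_into \<Phi> i))"
    by simp
  moreover have bases: "tower_base M f n (A (from_nat_into \<Phi> i))" for i
    using base from_nat_into[OF \<Phi>(2)] by blast
  ultimately show thesis
    using tower_base_sets[OF bases] by (intro that[of "\<lambda>i. A (from_nat_into \<Phi> i)"]) (auto simp: prob_eq_1)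
qed

text \<open>Subsets of bases are bases, so the countable cover can be made disjoint; continuity from
  below allows a finite cut-off.\<close>

lemma tower_base_finite_disjoint_cover:
  assumes "standard_prob_space M" "free_action M f" "\<delta> > 0"
  obtains C :: "nat \<Rightarrow> 'a set" and r where "\<And>i. tower_base M f n (C i)"
    "disjoint_family_on C {..<r}" "prob (\<Union>i<r. C i) > 1 - \<delta>"
proof -
  obtain A :: "nat \<Rightarrow> 'a set" where A: "\<And>i. tower_base M f n (A i)" "prob (\<Union>i. A i) = 1"
    using tower_base_countable_cover[OF assms(1,2)] by blast
  have A_sets: "A i \<in> sets M" for i
    using tower_base_sets[OF A(1)] .
  then have C_sets: "disjointed A i \<in> sets M" for i
    using sets.range_disjointed_sets[of A M] by blast
  have "(\<lambda>r. prob (\<Union>i<r. A i)) \<longlonglongrightarrow> prob (\<Union>r. \<Union>i<r. A i)"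
    using A_sets by (intro finite_Lim_measure_incseq monoI UN_mono) auto
  also have "(\<Union>r. \<Union>i<r. A i) = (\<Union>i. A i)"
    by auto
  finally have "eventually (\<lambda>r. prob (\<Union>i<r. A i) > 1 - \<delta>) sequentially"
    using A(2) assms(3) by (intro order_tendstoD(1)) auto
  then obtain r where r: "prob (\<Union>i<r. A i) > 1 - \<delta>"
    by (auto simp: eventually_sequentially)
  show thesis
  proof (rule that[of "disjointed A" r])
    show "tower_base M f n (disjointed A i)" for i
      by (rule tower_base_subset[OF A(1) disjointed_subset C_sets])
    show "disjoint_family_on (disjointed A) {..<r}"
      using disjoint_family_disjointed[of A] by (auto simp: disjoint_family_on_def)
    show "prob (\<Union>i<r. disjointed A i) > 1 - \<delta>"
      using r finite_UN_disjointed_eq[of A r] by (simp add: atLeast0LessThan)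
  qed
qed

section \<open>Enlarging a tower\<close>

text \<open>A point outside the exceptional union either meets \<open>C\<close> at an inner time,
  and the regular pattern covers it, or does not meet \<open>C\<close> in the whole larger box, and
  its visit to \<open>B\<close> survives.\<close>

lemma tower_base_replace_on_tower:
  assumes B: "tower_base M f n B" and C: "tower_base M f (\<chi> j. p * n $ j) C" and n: "\<And>j. n $ j > 0"
  obtains B' where "tower_base M f n B'"
    "tower M f n B \<union> tower M f (\<chi> j. p * n $ j) C \<subseteq> tower M f n B' \<union>
       (\<Union>k\<in>tower_indices (\<chi> j. (p + 1) * n $ j) - {k. \<forall>j. n $ j \<le> k $ j \<and> k $ j < p * n $ j}.
          f k -` C \<inter> space M)"
proof -
  define T where "T = tower M f (\<chi> j. p * n $ j) C"
  \<comment> \<open>With \<open>q\<close> at least 1, \<open>s q\<close> dominates every index of an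
    \<open>n\<close>-tower; with \<open>q\<close> below \<open>p\<close>, \<open>s q + k\<close>
    stays in the large box for each such index \<open>k\<close>.\<close>
  define Q where "Q = {q :: nat ^ 'd. \<forall>j. 1 \<le> q $ j \<and> q $ j < p}"
  define s where "s q = (\<chi> j. q $ j * n $ j)" for q :: "nat ^ 'd"
  define B' where "B' = (B - T) \<union> (\<Union>q\<in>Q. f (s q) -` C \<inter> space M)"
  have [measurable]: "B \<in> sets M" "C \<in> sets M"
    using B C by (auto intro: tower_base_sets)
  have "finite Q"
    using finite_vec_box[of 1 "\<chi> j. p"] by (simp add: Q_def)
  then have B'_sets: "B' \<in> sets M"
    unfolding B'_def T_def by measurable
  have T_iff: "x \<in> T \<longleftrightarrow> x \<in> space M \<and> (\<exists>k. (\<forall>j. k $ j < p * n $ j) \<and> f k x \<in> C)" for x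
    by (auto simp: T_def tower_def tower_indices_def)
  \<comment> \<open>From \<open>f l x\<close> the set \<open>C\<close> is reached at time
    \<open>s q + k - l\<close>, which lies in the large box, so \<open>f l x\<close> would be in
    \<open>T\<close>. The truncated subtraction is exact by \<open>le\<close>.\<close>
  have mixed: False if x: "x \<in> space M" and l: "l \<in> tower_indices n" "f l x \<in> B - T"
    and k: "k \<in> tower_indices n" and q: "q \<in> Q" "f (s q) (f k x) \<in> C" for x k l q
  proof -
    have le: "l $ j \<le> s q $ j + k $ j" and less: "s q $ j + k $ j < p * n $ j" for j
    proof -
      have "n $ j \<le> q $ j * n $ j" "n $ j + q $ j * n $ j \<le> p * n $ j"
        using q(1) mult_le_mono1[of "Suc (q $ j)" p "n $ j"] by (auto simp: Q_def Suc_le_eq)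
      moreover have "l $ j < n $ j" "k $ j < n $ j"
        using l(1) k by (auto simp: tower_indices_def)
      ultimately show "l $ j \<le> s q $ j + k $ j" "s q $ j + k $ j < p * n $ j"
        unfolding s_def vec_lambda_beta by linarith+
    qed
    define m where "m = s q + k - l"
    have "m + l = s q + k"
      using le by (simp add: m_def vec_eq_iff)
    then have "f m (f l x) \<in> C"
      using q(2) x by (simp add: f_f)
    moreover have "m $ j < p * n $ j" for j
      using less[of j] by (simp add: m_def)
    ultimately have "f l x \<in> T"
      using x by (auto simp: T_iff f_in_space)
    with l(2) show False by simp
  qed
  have "tower_base M f n B'"
  proof (rule tower_baseI[OF B'_sets])
    fix x k l
    assume x: "x \<in> space M" "k \<in> tower_indices n" "l \<in> tower_indices n" "f k x \<in> B'" "f l x \<in> B'"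
    consider "f k x \<in> B - T" "f l x \<in> B - T"
      | q r where "q \<in> Q" "f (s q) (f k x) \<in> C" "r \<in> Q" "f (s r) (f l x) \<in> C"
      using x mixed[OF x(1)] unfolding B'_def by blast
    then show "k = l"
    proof cases
      case 1
      then show ?thesis
        using tower_baseD[OF B x(1-3)] by simp
    next
      case 2
      have "s q + k \<in> tower_indices (\<chi> j. p * n $ j)" if "q \<in> Q" "k \<in> tower_indices n" for q k
      proof -
        have "q $ j * n $ j + k $ j < p * n $ j" for j
        proof -
          have "Suc (q $ j) * n $ j \<le> p * n $ j"
            using that(1) by (intro mult_le_mono1) (simp add: Q_def Suc_le_eq)
          with that(2) show ?thesis
            by (auto simp: tower_indices_def intro: less_le_trans[rotated])
        qed
        then show ?thesis
          by (simp add: tower_indices_def s_def)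
      qed
      \<comment> \<open>In the large box the time of a visit to \<open>C\<close> is unique;
        reduction modulo \<open>n\<close> then recovers the index.\<close>
      then have eq: "s q + k = s r + l"
        using 2 x by (intro tower_baseD[OF C x(1)]) (auto simp: f_f)
      have "k $ j = l $ j" for j
      proof -
        have "(q $ j * n $ j + k $ j) mod n $ j = (r $ j * n $ j + l $ j) mod n $ j"
          using eq by (simp add: vec_eq_iff s_def)
        with x(2,3) show ?thesis
          by (simp add: tower_indices_def)
      qed
      then show ?thesis
        by (simp add: vec_eq_iff)
    qed
  qed
  \<comment> \<open>Division with remainder by \<open>n\<close> splits \<open>k\<close> into
    \<open>s q + i\<close>; the bounds on \<open>k\<close> give
    \<open>1 \<le> q < p\<close>.\<close>
  moreover have inner: "x \<in> tower M f n B'"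
    if x: "x \<in> space M" "f k x \<in> C" and k: "\<And>j. n $ j \<le> k $ j" "\<And>j. k $ j < p * n $ j" for x k
  proof -
    define q where "q = (\<chi> j. k $ j div n $ j)"
    define i where "i = (\<chi> j. k $ j mod n $ j)"
    have "s q + i = k"
      by (simp add: s_def q_def i_def vec_eq_iff div_mult_mod_eq)
    moreover have "q \<in> Q"
      using k n by (auto simp: Q_def q_def div_greater_zero_iff Suc_le_eq less_mult_imp_div_less)
    ultimately have "f i x \<in> B'"
      using x by (auto simp: B'_def f_f f_in_space)
    moreover have "i \<in> tower_indices n"
      using n by (simp add: i_def tower_indices_def)
    ultimately show ?thesis
      using x by (auto simp: tower_def)
  qed
  have "x \<in> tower M f n B' \<or> (\<exists>k\<in>tower_indices (\<chi> j. (p + 1) * n $ j) -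
      {k. \<forall>j. n $ j \<le> k $ j \<and> k $ j < p * n $ j}. x \<in> f k -` C \<inter> space M)"
    if "x \<in> tower M f n B \<union> T" for x
  proof (rule ccontr)
    assume not: "\<not> ?thesis"
    have x: "x \<in> space M"
      using that by (auto simp: tower_def T_iff)
    \<comment> \<open>The factor is \<open>p + 1\<close> because a visit of \<open>f l x\<close> to
      \<open>C\<close> at time \<open>k\<close> is one of \<open>x\<close> at time
      \<open>k + l\<close>.\<close>
    have far: "f k x \<notin> C" if "\<forall>j. k $ j < (p + 1) * n $ j" for k
    proof
      assume "f k x \<in> C"
      with not x that have "\<forall>j. n $ j \<le> k $ j \<and> k $ j < p * n $ j"
        by (auto simp: tower_indices_def)
      with inner[OF x \<open>f k x \<in> C\<close>] not show False
        by auto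
    qed
    have "x \<notin> T"
    proof
      assume "x \<in> T"
      then obtain k where k: "\<forall>j. k $ j < p * n $ j" "f k x \<in> C"
        by (auto simp: T_iff)
      have "k $ j < (p + 1) * n $ j" for j
        using spec[OF k(1), of j] by simp
      with far k(2) show False by blast
    qed
    with that obtain l where l: "l \<in> tower_indices n" "f l x \<in> B"
      by (auto simp: tower_def)
    have "f l x \<notin> T"
    proof
      assume "f l x \<in> T"
      then obtain k where k: "\<forall>j. k $ j < p * n $ j" "f k (f l x) \<in> C"
        by (auto simp: T_iff)
      have "(k + l) $ j < (p + 1) * n $ j" for j
        using add_strict_mono[of "k $ j" "p * n $ j" "l $ j" "n $ j"] k(1) l(1)
        by (simp add: tower_indices_def)
      then show False
        using far[of "k + l"] k(2) x by (simp add: f_f)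
    qed
    then have "x \<in> tower M f n B'"
      using l x by (auto simp: tower_def B'_def)
    with not show False by blast
  qed
  ultimately show thesis
    unfolding T_def by (intro that[of B']) blast+
qed

text \<open>The cover is fixed before \<open>B\<close>, so \<open>\<gamma>\<close> does not depend
  on \<open>B\<close>. Averaging over the cover yields one tower whose gain exceeds its boundary
  cost.\<close>

lemma tower_measure_increment:
  assumes "standard_prob_space M" "free_action M f" "\<epsilon> > 0" and n: "\<And>j. n $ j > 0"
  obtains \<gamma> :: real where "\<gamma> > 0"
    "\<And>B. \<lbrakk>tower_base M f n B; prob (tower M f n B) < 1 - \<epsilon>\<rbrakk> \<Longrightarrow>
       \<exists>B'. tower_base M f n B' \<and> prob (tower M f n B) + \<gamma> \<le> prob (tower M f n B')"
proof -
  \<comment> \<open>Boundaries and the incomplete cover each cost a share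
    \<open>\<epsilon> / 4\<close>, leaving more than \<open>\<epsilon> / 2\<close> of an uncovered
    part of measure above \<open>\<epsilon>\<close>.\<close>
  obtain p where p: "p > 0"
    "real ((p + 1) ^ CARD('d) - (p - 1) ^ CARD('d)) \<le> \<epsilon> / 4 * real p ^ CARD('d)"
    using ex_power_shell_small[of "\<epsilon> / 4" "CARD('d)"] assms(3) by auto
  define N where "N = card (tower_indices (\<chi> j. p * n $ j))"
  let ?K = "tower_indices (\<chi> j. (p + 1) * n $ j) - {k. \<forall>j. n $ j \<le> k $ j \<and> k $ j < p * n $ j}"
  have N: "N = p ^ CARD('d) * card (tower_indices n)"
    unfolding N_def card_tower_indices vec_lambda_beta prod.distrib by simp
  have "card (tower_indices n) > 0"
    using n by (simp add: card_tower_indices)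
  then have "N \<ge> 1"
    using p(1) by (simp add: N Suc_le_eq)
  have K: "real (card ?K) \<le> \<epsilon> / 4 * N"
    using mult_right_mono[OF p(2), of "real (card (tower_indices n))"]
    unfolding card_tower_indices_diff_box[OF p(1)] N of_nat_mult of_nat_power by (simp add: mult.assoc)
  obtain C :: "nat \<Rightarrow> 'a set" and r where C: "\<And>i. tower_base M f (\<chi> j. p * n $ j) (C i)"
    "disjoint_family_on C {..<r}" "prob (\<Union>i<r. C i) > 1 - \<epsilon> / 4"
    using tower_base_finite_disjoint_cover[OF assms(1,2), of "\<epsilon> / 4"] assms(3) by auto
  have C_sets [measurable]: "C i \<in> sets M" for i
    using tower_base_sets[OF C(1)] .
  define T where "T i = tower M f (\<chi> j. p * n $ j) (C i)" for i
  have T_sets [measurable]: "T i \<in> sets M" for i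
    by (simp add: T_def sets_tower)
  \<comment> \<open>Dividing by \<open>r + 1\<close> makes
    \<open>r * \<gamma> < \<epsilon> / 2\<close> strict, also for \<open>r = 0\<close>.\<close>
  define \<gamma> where "\<gamma> = \<epsilon> / (2 * (r + 1))"
  show thesis
  proof (rule that[of \<gamma>])
    show "\<gamma> > 0"
      using assms(3) by (simp add: \<gamma>_def)
    fix B
    assume B: "tower_base M f n B" "prob (tower M f n B) < 1 - \<epsilon>"
    define E where "E = space M - tower M f n B"
    have [measurable]: "B \<in> sets M"
      by (rule tower_base_sets[OF B(1)])
    have E_sets [measurable]: "E \<in> sets M"
      unfolding E_def by measurable
    have E: "prob E > \<epsilon>"
      using B(2) by (simp add: E_def prob_compl sets_tower)
    \<comment> \<open>As \<open>f k\<close> preserves measure, at each time all but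
      \<open>\<epsilon> / 4\<close> of \<open>E\<close> visits the cover.\<close>
    have "prob E - \<epsilon> / 4 \<le> (\<Sum>i<r. prob (f k -` C i \<inter> space M \<inter> E))" for k
    proof -
      let ?U = "f k -` (\<Union>i<r. C i) \<inter> space M"
      have U [measurable]: "?U \<in> sets M"
        by measurable
      have "prob E \<le> prob (?U \<inter> E \<union> (space M - ?U))"
        using sets.sets_into_space[OF E_sets] by (intro finite_measure_mono) auto
      also have "\<dots> \<le> prob (?U \<inter> E) + prob (space M - ?U)"
        by (intro measure_Un_le) auto
      also have "prob (space M - ?U) \<le> \<epsilon> / 4"
        using C(3) by (simp add: prob_compl[OF U] measure_vimage_f)
      also have "?U \<inter> E = (\<Union>i<r. f k -` C i \<inter> space M \<inter> E)"
        by auto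
      also have "prob \<dots> = (\<Sum>i<r. prob (f k -` C i \<inter> space M \<inter> E))"
        using C(2) by (intro finite_measure_finite_Union) (auto simp: disjoint_family_on_def)
      finally show ?thesis by simp
    qed
    then have "(\<Sum>k\<in>tower_indices (\<chi> j. p * n $ j). prob E - \<epsilon> / 4) \<le>
        (\<Sum>k\<in>tower_indices (\<chi> j. p * n $ j). \<Sum>i<r. prob (f k -` C i \<inter> space M \<inter> E))"
      by (intro sum_mono)
    also have "\<dots> = (\<Sum>i<r. prob (T i \<inter> E))"
      unfolding T_def measure_tower_Int[OF C(1) E_sets] by (rule sum.swap)
    finally have sum_T: "N * (prob E - \<epsilon> / 4) \<le> (\<Sum>i<r. prob (T i \<inter> E))"
      by (simp add: N_def)
    have "(\<Sum>i<r. prob (C i)) = prob (\<Union>i<r. C i)"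
      using C(2) by (intro finite_measure_finite_Union[symmetric]) auto
    then have "card ?K * (\<Sum>i<r. prob (C i)) \<le> card ?K"
      using mult_left_mono[of "prob (\<Union>i<r. C i)" 1 "real (card ?K)"] by simp
    then have sum_C: "(\<Sum>i<r. card ?K * prob (C i)) \<le> \<epsilon> / 4 * N"
      using K by (simp add: sum_distrib_left)
    \<comment> \<open>Otherwise the total gain is at most \<open>r * \<gamma>\<close>, whereas
      \<open>sum_T\<close> and \<open>sum_C\<close> bound it below by
      \<open>N * (prob E - \<epsilon> / 2)\<close>.\<close>
    have "\<exists>i<r. \<gamma> \<le> prob (T i \<inter> E) - card ?K * prob (C i)"
    proof (rule ccontr)
      assume "\<not> ?thesis"
      then have "(\<Sum>i<r. prob (T i \<inter> E) - card ?K * prob (C i)) \<le> real r * \<gamma>"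
        using sum_bounded_above[of "{..<r}" "\<lambda>i. prob (T i \<inter> E) - card ?K * prob (C i)" \<gamma>]
        by (auto simp: not_le less_imp_le)
      moreover have "real r * \<gamma> < \<epsilon> / 2"
        using assms(3) by (simp add: \<gamma>_def field_simps)
      moreover have "1 * (\<epsilon> / 2) \<le> N * (prob E - \<epsilon> / 4 - \<epsilon> / 4)"
        using \<open>N \<ge> 1\<close> E assms(3) by (intro mult_mono) auto
      ultimately show False
        using sum_T sum_C by (simp add: sum_subtractf algebra_simps)
    qed
    then obtain i where i: "\<gamma> \<le> prob (T i \<inter> E) - card ?K * prob (C i)"
      by blast
    obtain B' where B': "tower_base M f n B'"
      "tower M f n B \<union> T i \<subseteq> tower M f n B' \<union> (\<Union>k\<in>?K. f k -` C i \<inter> space M)"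
      using tower_base_replace_on_tower[OF B(1) C(1) n] unfolding T_def by blast
    have [measurable]: "B' \<in> sets M"
      by (rule tower_base_sets[OF B'(1)])
    have "finite ?K"
      using finite_tower_indices by blast
    have "prob (tower M f n B) + prob (T i \<inter> E) = prob (tower M f n B \<union> T i \<inter> E)"
      by (intro finite_measure_Union[symmetric]) (auto simp: E_def)
    also have "\<dots> \<le> prob (tower M f n B' \<union> (\<Union>k\<in>?K. f k -` C i \<inter> space M))"
      using B'(2) \<open>finite ?K\<close> by (intro finite_measure_mono sets.Un sets.finite_UN) auto
    also have "\<dots> \<le> prob (tower M f n B') + prob (\<Union>k\<in>?K. f k -` C i \<inter> space M)"
      using \<open>finite ?K\<close> by (intro measure_Un_le sets.finite_UN) auto
    also have "prob (\<Union>k\<in>?K. f k -` C i \<inter> space M) \<le> (\<Sum>k\<in>?K. prob (f k -` C i \<inter> space M))"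
      using \<open>finite ?K\<close> by (intro finite_measure_subadditive_finite) auto
    also have "\<dots> = card ?K * prob (C i)"
      by (simp add: measure_vimage_f)
    finally show "\<exists>B'. tower_base M f n B' \<and> prob (tower M f n B) + \<gamma> \<le> prob (tower M f n B')"
      using B'(1) i by (intro exI[of _ B']) auto
  qed
qed

end

section \<open>Iterating the enlargement\<close>

theorem theorem1p2:
  fixes M :: "'a measure"
    and f :: "nat ^ 'd \<Rightarrow> 'a \<Rightarrow> 'a"
    and n :: "nat ^ 'd"
    and \<epsilon> :: real
  assumes "\<epsilon> > 0"
    and "\<forall>j. n $ j > 0"
    and "standard_prob_space M"
    and "atomless M"
    and "mp_action M f"
    and "free_action M f"
  shows "\<exists>B. tower_base M f n B \<and> measure M (tower M f n B) \<ge> 1 - \<epsilon>"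
proof (rule ccontr)
  assume not: "\<not> ?thesis"
  interpret prob_space M
    using assms(3) by (simp add: standard_prob_space_def)
  interpret mp_system M f
    by unfold_locales (rule assms(5))
  obtain \<gamma> :: real where \<gamma>: "\<gamma> > 0"
    "\<And>B. \<lbrakk>tower_base M f n B; prob (tower M f n B) < 1 - \<epsilon>\<rbrakk> \<Longrightarrow>
       \<exists>B'. tower_base M f n B' \<and> prob (tower M f n B) + \<gamma> \<le> prob (tower M f n B')"
    using tower_measure_increment[OF assms(3,6,1)] assms(2) by blast
  \<comment> \<open>By \<open>not\<close>, every tower can be enlarged, so from the empty base each
    round adds at least \<open>\<gamma>\<close>, until the measure would exceed 1.\<close>
  have "\<exists>B. tower_base M f n B \<and> m * \<gamma> \<le> prob (tower M f n B)" for m :: nat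
  proof (induction m)
    case 0
    show ?case
      by (intro exI[of _ "{}"]) (auto simp: tower_base_def disjoint_family_on_def)
  next
    case (Suc m)
    then obtain B where "tower_base M f n B" "m * \<gamma> \<le> prob (tower M f n B)"
      by blast
    moreover from this not obtain B' where
      "tower_base M f n B'" "prob (tower M f n B) + \<gamma> \<le> prob (tower M f n B')"
      using \<gamma>(2) by (meson not_le)
    ultimately show ?case
      by (intro exI[of _ B']) (auto simp: distrib_right)
  qed
  moreover obtain m :: nat where "1 < m * \<gamma>"
    using reals_Archimedean3[OF \<gamma>(1)] by blast
  ultimately show False
    using prob_le_1 by (meson not_le order_trans)
qed

end
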